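(* Let $0<\alpha<1$. For each $n\geq 1$, for any continuous random variable $X$, \[V_{n,\alpha max}^*(X) \geq v_{n,max}^*,\] and the inequality is sharp, i.e. $v_{n,max}^*$ is the best lower bound: for any $\delta>0$ there exists a continuous random variable $X$ such that $V_{n,\alpha max}^*(X)\le v_{n,max}^*+\delta$.
   Context: Let $X_1,\dots,X_n$ be independent random variables, each with the same distribution as $X$, and let $M_n:=\max\{X_1,\dots,X_n\}$. A stopping rule is a stopping time $\tau$ with values in $\{1,\dots,n\}$ adapted to the natural filtration of $X_1,\dots,X_n$. A continuous random variable is one whose distribution is continuous. For $0<\alpha<1$ define \[V_{n,\alpha max}^*(X):=\sup_{\tau}P(X_\tau\ge \alpha M_n),\qquad V_{n,max}^*(X):=\sup_\tau P(X_\tau\ge M_n)=\sup_\tau P(X_\tau=M_n),\] where the suprema are over all stopping rules $\tau$. These are the optimal win probabilities in "Game Proportion of the Max" (win is to stop at an observation that is at least the proportion $\alpha$ of the maximum of the sequence) and in "Game Max" (win is to stop at an observation that is the maximum of the sequence), respectively. It is known (Gilbert and Mosteller) that $V_{n,max}^*(X)$ takes the same value for every continuous random variable $X$; this common value is denoted $v_{n,max}^*$.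
   Formalization: The lower bound is stated for continuous X that is almost surely nonnegative, since it fails otherwise (X uniform on [-1,0], n=1 gives V=0 < 1=v); the X in the sharpness part is also nonnegative. *)

theory Defs
  imports "HOL-Probability.Probability"
begin

definition continuous_law :: "real measure \<Rightarrow> bool" where
  "continuous_law D \<longleftrightarrow> real_distribution D \<and> continuous_on UNIV (cdf D)"

text \<open>\<open>X 1, \<dots>, X n\<close> are independent copies of a random variable with law \<open>D\<close>;
  the values of \<open>X\<close> at other indices play no role.\<close>

definition iid_copies :: "'a measure \<Rightarrow> (nat \<Rightarrow> 'a \<Rightarrow> real) \<Rightarrow> nat \<Rightarrow> real measure \<Rightarrow> bool" where
  "iid_copies M X n D \<longleftrightarrow>
     prob_space M \<and>
     prob_space.indep_vars M (\<lambda>_. borel) X {1..n} \<and>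
     (\<forall>i\<in>{1..n}. distr M borel (X i) = D)"

text \<open>The sigma-algebra generated by \<open>X 1, \<dots>, X k\<close>, as the pullback under the random vector
  \<open>(X 1, \<dots>, X k)\<close> (trivial for \<open>k = 0\<close>).\<close>

definition nat_filtration :: "'a measure \<Rightarrow> (nat \<Rightarrow> 'a \<Rightarrow> real) \<Rightarrow> nat \<Rightarrow> 'a measure" where
  "nat_filtration M X k =
     vimage_algebra (space M) (\<lambda>\<omega>. \<lambda>i\<in>{1..k}. X i \<omega>) (\<Pi>\<^sub>M i\<in>{1..k}. borel)"

definition stopping_rules :: "'a measure \<Rightarrow> (nat \<Rightarrow> 'a \<Rightarrow> real) \<Rightarrow> nat \<Rightarrow> ('a \<Rightarrow> nat) set" where
  "stopping_rules M X n =
     {\<tau>. stopping_time (nat_filtration M X) \<tau> \<and> (\<forall>\<omega>\<in>space M. \<tau> \<omega> \<in> {1..n})}"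

definition sample_max :: "(nat \<Rightarrow> 'a \<Rightarrow> real) \<Rightarrow> nat \<Rightarrow> 'a \<Rightarrow> real" where
  "sample_max X n \<omega> = Max ((\<lambda>i. X i \<omega>) ` {1..n})"

definition V_prop_max :: "real \<Rightarrow> 'a measure \<Rightarrow> (nat \<Rightarrow> 'a \<Rightarrow> real) \<Rightarrow> nat \<Rightarrow> real" where
  "V_prop_max \<alpha> M X n =
     (SUP \<tau>\<in>stopping_rules M X n.
        measure M {\<omega>\<in>space M. X (\<tau> \<omega>) \<omega> \<ge> \<alpha> * sample_max X n \<omega>})"

definition V_max :: "'a measure \<Rightarrow> (nat \<Rightarrow> 'a \<Rightarrow> real) \<Rightarrow> nat \<Rightarrow> real" where
  "V_max M X n =
     (SUP \<tau>\<in>stopping_rules M X n.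
        measure M {\<omega>\<in>space M. X (\<tau> \<omega>) \<omega> \<ge> sample_max X n \<omega>})"

text \<open>The common value of \<open>V_max\<close> over all continuous laws (Gilbert and Mosteller). The sample
  space is fixed to the type \<open>nat \<Rightarrow> real\<close>, which carries the product space
  \<open>\<Pi>\<^sub>M i\<in>{1..n}. D\<close> and hence independent copies for every law \<open>D\<close>.\<close>

definition v_max :: "nat \<Rightarrow> real" where
  "v_max n = (THE v. \<forall>D (M :: (nat \<Rightarrow> real) measure) X.
     continuous_law D \<longrightarrow> iid_copies M X n D \<longrightarrow> V_max M X n = v)"

end

theory Submission
  imports Defs
begin

text \<open>
  Winning Game Max only depends on the ranks of the observations, and ranks do not change under an
  increasing transformation. This is why the optimal value of that game is the same for all
  continuous laws. If \<open>D\<close> and \<open>D'\<close> are continuous, the map that composes the distribution function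
  of \<open>D'\<close> with the quantile function of \<open>D\<close> is monotone on a set of full measure and carries \<open>D'\<close>
  to \<open>D\<close> (\<open>monotone_transport_exists\<close>). A player who observes \<open>D'\<close>-distributed variables can
  apply this map to each of them and play any rule designed for \<open>D\<close>: the transformed sample has the
  right joint law, almost surely it has no ties (\<open>no_ties\<close>), and without ties a maximal
  transformed value comes from a maximal original value. So the value under \<open>D'\<close> is at least the
  value under \<open>D\<close> (\<open>V_max_le\<close>), and the two are equal by symmetry. To move a stopping rule from
  one sample space to another, it is written as the first time at which the observed prefix enters a
  prescribed measurable set (\<open>stopping_rule_is_first_entry\<close>); this description mentions the
  observed values only.

  The lower bound is then immediate: for nonnegative observations \<open>\<alpha> M\<^sub>n \<le> M\<^sub>n\<close>, so a rule that wins
  Game Max also wins the proportional game.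

  For sharpness, take \<open>X = exp (K Y)\<close> with \<open>Y\<close> uniform on the unit interval. A stop at \<open>X\<^sub>i\<close> that
  wins the proportional game and is beaten by some \<open>X\<^sub>j\<close> in Game Max forces
  \<open>0 < Y\<^sub>j - Y\<^sub>i \<le> - ln \<alpha> / K\<close>. The probability that two of the \<open>Y\<close>'s come that close tends to the
  probability of a tie, which is zero, as \<open>K\<close> grows (\<open>near_ties_vanish\<close>); hence the two values
  differ by less than \<open>\<delta>\<close> once \<open>K\<close> is large (\<open>V_prop_max_exp_le\<close>).
\<close>

section \<open>Continuous laws\<close>

lemma continuous_law_iff_no_atoms:
  "continuous_law D \<longleftrightarrow> real_distribution D \<and> (\<forall>x. measure D {x} = 0)"
  unfolding continuous_law_def continuous_on_eq_continuous_at[OF open_UNIV]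
  by (auto simp: finite_borel_measure.isCont_cdf[OF real_distribution.finite_borel_measure_M])

text \<open>
  The probability integral transform: \<open>F(X)\<close> is uniform on the unit interval when \<open>F\<close> is the
  continuous distribution function of \<open>X\<close>. By the intermediate value theorem every \<open>q\<close> strictly
  between 0 and 1 is a value \<open>F(x)\<close>, and the event \<open>F(X) \<le> p\<close> contains \<open>X \<le> x\<close> when \<open>F(x) = p\<close>
  and is contained in it when \<open>F(x) > p\<close>.
\<close>
lemma cdf_probability_transform:
  assumes "continuous_law D" "0 \<le> p" "p \<le> 1"
  shows "measure D {x. cdf D x \<le> p} = p"
proof -
  interpret D: cdf_distribution D
    using assms(1) by (simp add: continuous_law_def cdf_distribution_def)
  have cont: "continuous_on {a..b} (cdf D)" for a b
    using assms(1) continuous_on_subset unfolding continuous_law_def by blast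
  have attained: "\<exists>x. cdf D x = q" if q: "0 < q" "q < 1" for q
  proof -
    obtain a where a: "cdf D a < q"
      using order_tendstoD(2)[OF D.cdf_lim_at_bot q(1)]
      by (auto simp: eventually_at_bot_linorder)
    obtain b where b: "q < cdf D b"
      using order_tendstoD(1)[OF D.cdf_lim_at_top_prob q(2)]
      by (auto simp: eventually_at_top_linorder)
    have "a \<le> b"
      using a b D.cdf_nondecreasing[of b a] by linarith
    then show ?thesis
      using IVT'[of "cdf D" a q b] a b cont by auto
  qed
  have sets: "{x. cdf D x \<le> q} \<in> sets D" for q
    by (subst D.events_eq_borel) measurable
  have upper: "measure D {x. cdf D x \<le> p} \<le> q" if q: "p < q" "q < 1" for q
  proof -
    obtain x where x: "cdf D x = q"
      using attained[of q] assms q by auto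
    have "{y. cdf D y \<le> p} \<subseteq> {..x}"
    proof
      fix y assume "y \<in> {y. cdf D y \<le> p}"
      then have "\<not> x \<le> y"
        using q x D.cdf_nondecreasing[of x y] by auto
      then show "y \<in> {..x}" by simp
    qed
    then show ?thesis
      unfolding x[symmetric] cdf_def by (intro D.finite_measure_mono) (auto simp: D.events_eq_borel)
  qed
  show ?thesis
  proof (rule antisym)
    show "measure D {x. cdf D x \<le> p} \<le> p"
    proof (cases "p = 1")
      case False
      then show ?thesis
        using assms upper by (intro dense_ge_bounded[of p 1]) auto
    qed auto
    show "p \<le> measure D {x. cdf D x \<le> p}"
    proof (cases "p = 0 \<or> p = 1")
      case False
      then obtain x where x: "cdf D x = p"
        using attained[of p] assms by auto
      have "measure D {..x} \<le> measure D {x. cdf D x \<le> p}"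
        using x D.cdf_nondecreasing by (intro D.finite_measure_mono sets) auto
      then show ?thesis
        using x by (simp add: cdf_def)
    next
      case True
      then show ?thesis
        using D.cdf_bounded_prob D.prob_space by (auto simp: D.borel_UNIV)
    qed
  qed
qed

text \<open>
  The generalised inverse of a distribution function is monotone and satisfies its Galois
  connection on the open unit interval only, so the endpoints have to be excluded.
\<close>
lemma AE_cdf_strictly_between:
  assumes "continuous_law D"
  shows "AE x in D. 0 < cdf D x \<and> cdf D x < 1"
proof -
  interpret D: cdf_distribution D
    using assms by (simp add: continuous_law_def cdf_distribution_def)
  have sets: "{x. cdf D x \<le> q} \<in> sets D" "{x. cdf D x < q} \<in> sets D" for q
    by (subst D.events_eq_borel; measurable)+
  have "AE x in D. \<not> cdf D x \<le> 0"
    using cdf_probability_transform[OF assms, of 0] sets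
    by (subst AE_iff_measurable[OF sets(1)[of 0]]) (auto simp: D.emeasure_eq_measure)
  moreover have "AE x in D. cdf D x < 1"
  proof -
    have "1 \<le> measure D {x. cdf D x < 1}"
    proof (rule dense_le_bounded[of 0])
      fix q :: real assume q: "0 < q" "q < 1"
      have "measure D {x. cdf D x \<le> q} \<le> measure D {x. cdf D x < 1}"
        using q by (intro D.finite_measure_mono sets) auto
      then show "q \<le> measure D {x. cdf D x < 1}"
        using cdf_probability_transform[OF assms, of q] q by simp
    qed simp
    then have "measure D {x. cdf D x < 1} = 1"
      using D.prob_le_1 antisym by blast
    then show ?thesis
      using D.prob_eq_1[OF sets(2)[of 1]] by simp
  qed
  ultimately show ?thesis
    by eventually_elim auto
qed

text \<open>
  The transport is the quantile function of \<open>D\<close> after the distribution function of \<open>D'\<close>.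
  Monotonicity is claimed on a set of full measure only, because the quantile function has an
  arbitrary value at the levels 0 and 1.
\<close>
lemma monotone_transport_exists:
  assumes D: "real_distribution D" and D': "continuous_law D'"
  obtains g :: "real \<Rightarrow> real" and S where "g \<in> borel_measurable borel" "mono_on S g"
    "AE x in D'. x \<in> S" "distr D' borel g = D"
proof -
  interpret D: cdf_distribution D
    using D by (simp add: cdf_distribution_def)
  interpret D': cdf_distribution D'
    using D' by (simp add: continuous_law_def cdf_distribution_def)
  define q where "q u = (if u \<in> {0<..<1} then D.I u else 0)" for u
  define S where "S = {x. 0 < cdf D' x \<and> cdf D' x < 1}"
  have [measurable]: "q \<in> borel_measurable borel"
    using D.measurable_CI unfolding q_def
    by (subst (asm) measurable_restrict_space_iff[where c=0]) auto
  have AE_S: "AE x in D'. x \<in> S"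
    using AE_cdf_strictly_between[OF D'] by (simp add: S_def)
  have g: "(\<lambda>x. q (cdf D' x)) \<in> borel_measurable borel"
    by measurable
  have g': "(\<lambda>x. q (cdf D' x)) \<in> measurable D' borel"
    using g by (simp cong: measurable_cong_sets add: D'.events_eq_borel)
  \<comment> \<open>This turns the law of the transported variable into the uniform law of \<open>cdf D'\<close> under \<open>D'\<close>.\<close>
  have Galois: "q (cdf D' x) \<le> t \<longleftrightarrow> cdf D' x \<le> cdf D t" if "x \<in> S" for x t
    using that D.pseudoinverse[of "cdf D' x" t] by (simp add: S_def q_def)
  have mono: "mono_on S (\<lambda>x. q (cdf D' x))"
    using D.mono_I D'.cdf_nondecreasing
    by (auto simp: mono_on_def S_def q_def)
  have "distr D' borel (\<lambda>x. q (cdf D' x)) = D"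
  proof (rule cdf_unique)
    show "real_distribution (distr D' borel (\<lambda>x. q (cdf D' x)))"
      using g' by (rule D'.real_distribution_distr)
    show "cdf (distr D' borel (\<lambda>x. q (cdf D' x))) = cdf D"
    proof
      fix t
      have "cdf (distr D' borel (\<lambda>x. q (cdf D' x))) t = measure D' {x. q (cdf D' x) \<le> t}"
        using g' by (auto simp: cdf_def measure_distr D'.borel_UNIV vimage_def)
      also have "\<dots> = measure D' {x. cdf D' x \<le> cdf D t}"
        by (rule D'.finite_measure_eq_AE)
           (use AE_S in \<open>auto simp: Galois D'.events_eq_borel\<close>)
      also have "\<dots> = cdf D t"
        using cdf_probability_transform[OF D'] D.cdf_nonneg D.cdf_bounded_prob by auto
      finally show "cdf (distr D' borel (\<lambda>x. q (cdf D' x))) t = cdf D t" .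
    qed
  qed (fact D)
  with g mono AE_S show ?thesis
    using that by blast
qed

section \<open>Independent copies\<close>

lemma iid_copies_measurable:
  assumes "iid_copies M X n D" "i \<in> {1..n}"
  shows "X i \<in> borel_measurable M"
  using assms prob_space.indep_vars_def[of M "\<lambda>_. borel" X "{1..n}"]
  by (auto simp: iid_copies_def)

lemma iid_copies_AE:
  assumes "iid_copies M X n D" "i \<in> {1..n}" "AE x in D. P x"
  shows "AE \<omega> in M. P (X i \<omega>)"
proof -
  have law: "distr M borel (X i) = D"
    using assms(1,2) by (simp add: iid_copies_def)
  have "AE x in distr M borel (X i). P x"
    unfolding law by (rule assms(3))
  then show ?thesis
    by (rule AE_distrD[OF iid_copies_measurable[OF assms(1,2)]])
qed

lemma iid_copies_compose:
  assumes "iid_copies M X n D" "h \<in> borel_measurable borel"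
  shows "iid_copies M (\<lambda>i \<omega>. h (X i \<omega>)) n (distr D borel h)"
proof -
  interpret prob_space M
    using assms(1) by (simp add: iid_copies_def)
  have "distr M borel (\<lambda>\<omega>. h (X i \<omega>)) = distr D borel h" if "i \<in> {1..n}" for i
    using distr_distr[OF assms(2) iid_copies_measurable[OF assms(1) that]] assms(1) that
    by (simp add: iid_copies_def comp_def)
  then show ?thesis
    using assms indep_vars_compose2[of "\<lambda>_. borel" X "{1..n}" "\<lambda>_. h" "\<lambda>_. borel"]
    by (simp add: iid_copies_def prob_space_axioms)
qed

lemma iid_copies_joint_law:
  assumes "iid_copies M X n D" "n \<ge> 1"
  shows "distr M (\<Pi>\<^sub>M i\<in>{1..n}. borel) (\<lambda>\<omega>. \<lambda>i\<in>{1..n}. X i \<omega>) = (\<Pi>\<^sub>M i\<in>{1..n}. D)"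
proof -
  interpret prob_space M
    using assms(1) by (simp add: iid_copies_def)
  have "distr M (\<Pi>\<^sub>M i\<in>{1..n}. borel) (\<lambda>\<omega>. \<lambda>i\<in>{1..n}. X i \<omega>) = (\<Pi>\<^sub>M i\<in>{1..n}. distr M borel (X i))"
    using assms iid_copies_measurable[OF assms(1)]
    by (subst indep_vars_iff_distr_eq_PiM'[symmetric]) (auto simp: iid_copies_def)
  also have "\<dots> = (\<Pi>\<^sub>M i\<in>{1..n}. D)"
    using assms by (intro PiM_cong) (auto simp: iid_copies_def)
  finally show ?thesis .
qed

text \<open>
  Every law has independent copies on the sample space of real sequences. The description of
  \<open>v_max\<close> by \<open>THE\<close> quantifies over this space, so its uniqueness part needs a model there.
\<close>
lemma iid_copies_coordinates:
  assumes "real_distribution D" "n \<ge> 1"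
  shows "iid_copies (\<Pi>\<^sub>M i\<in>{1..n}. D) (\<lambda>i \<omega>. \<omega> i) n D"
proof -
  interpret D: real_distribution D by fact
  interpret P: prob_space "\<Pi>\<^sub>M i\<in>{1..n}. D"
    by (rule prob_space_PiM) (rule D.prob_space_axioms)
  have sets: "sets D = sets borel" by simp
  have coord: "(\<lambda>\<omega>. \<omega> i) \<in> borel_measurable (\<Pi>\<^sub>M i\<in>{1..n}. D)" if "i \<in> {1..n}" for i
    using measurable_component_singleton[OF that, of "\<lambda>_. D"]
    by (simp cong: measurable_cong_sets)
  have law: "distr (\<Pi>\<^sub>M i\<in>{1..n}. D) borel (\<lambda>\<omega>. \<omega> i) = D" if "i \<in> {1..n}" for i
    using distr_PiM_component[OF _ that, of "\<lambda>_. D"] D.prob_space_axioms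
    by (simp cong: distr_cong add: sets)
  have "distr (\<Pi>\<^sub>M i\<in>{1..n}. D) (\<Pi>\<^sub>M i\<in>{1..n}. borel) (\<lambda>\<omega>. \<lambda>i\<in>{1..n}. \<omega> i)
      = distr (\<Pi>\<^sub>M i\<in>{1..n}. D) (\<Pi>\<^sub>M i\<in>{1..n}. D) (\<lambda>\<omega>. \<omega>)"
    by (intro distr_cong sets_PiM_cong) (auto simp: space_PiM intro!: PiE_restrict)
  also have "\<dots> = (\<Pi>\<^sub>M i\<in>{1..n}. distr (\<Pi>\<^sub>M i\<in>{1..n}. D) borel (\<lambda>\<omega>. \<omega> i))"
    unfolding distr_id by (rule PiM_cong) (simp_all only: law)
  finally have "P.indep_vars (\<lambda>_. borel) (\<lambda>i \<omega>. \<omega> i) {1..n}"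
    using assms(2) coord by (subst P.indep_vars_iff_distr_eq_PiM') auto
  then show ?thesis
    using law P.prob_space_axioms by (simp add: iid_copies_def)
qed

lemma (in prob_space) indep_vars_pair:
  assumes "indep_vars M' X I" "i \<in> I" "j \<in> I" "i \<noteq> j"
  shows "indep_var (M' i) (X i) (M' j) (X j)"
proof -
  have "indep_var (M' i) ((\<lambda>f. f i) \<circ> (\<lambda>\<omega>. restrict (\<lambda>k. X k \<omega>) {i}))
      (M' j) ((\<lambda>f. f j) \<circ> (\<lambda>\<omega>. restrict (\<lambda>k. X k \<omega>) {j}))"
    using assms by (intro indep_var_compose[OF indep_var_restrict[OF assms(1)]]) auto
  then show ?thesis
    by (simp add: comp_def)
qed

text \<open>
  By Fubini, a tie of two independent variables has probability zero as soon as one of them gives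
  no mass to points.
\<close>
lemma no_ties:
  assumes iid: "iid_copies M X n D" and D: "continuous_law D"
    and ij: "i \<in> {1..n}" "j \<in> {1..n}" "i \<noteq> j"
  shows "AE \<omega> in M. X i \<omega> \<noteq> X j \<omega>"
proof -
  interpret prob_space M
    using iid by (simp add: iid_copies_def)
  interpret D: real_distribution D
    using D by (simp add: continuous_law_def)
  interpret DD: pair_sigma_finite D D ..
  have [measurable]: "X i \<in> borel_measurable M" "X j \<in> borel_measurable M"
    using iid ij by (auto intro: iid_copies_measurable)
  have "indep_vars (\<lambda>_. borel) X {1..n}"
    using iid by (simp add: iid_copies_def)
  then have "indep_var borel (X i) borel (X j)"
    by (rule indep_vars_pair[OF _ ij])
  then have joint: "distr M (borel \<Otimes>\<^sub>M borel) (\<lambda>\<omega>. (X i \<omega>, X j \<omega>)) = D \<Otimes>\<^sub>M D"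
    using iid ij unfolding indep_var_distribution_eq by (simp add: iid_copies_def)
  have "AE y in D. x \<noteq> y" for x
  proof -
    have "measure D {x} = 0"
      using D by (simp add: continuous_law_iff_no_atoms)
    then show ?thesis
      by (subst AE_iff_measurable[of "{x}"]) (auto simp: D.emeasure_eq_measure D.borel_UNIV)
  qed
  moreover have "Measurable.pred (D \<Otimes>\<^sub>M D) (\<lambda>z. fst z \<noteq> snd z)"
    by (simp cong: measurable_cong_sets)
  ultimately have "AE z in D \<Otimes>\<^sub>M D. fst z \<noteq> snd z"
    by (subst DD.AE_pair_iff[symmetric]) (auto simp: pred_def)
  then show ?thesis
    unfolding joint[symmetric] by (subst (asm) AE_distr_iff) auto
qed


text \<open>The events decrease to the event of a tie, so continuity of the measure from above applies.\<close>
lemma near_ties_vanish: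
  assumes iid: "iid_copies M X n D" and D: "continuous_law D"
    and ij: "i \<in> {1..n}" "j \<in> {1..n}" "i \<noteq> j"
  shows "(\<lambda>m. measure M {\<omega>\<in>space M. \<bar>X i \<omega> - X j \<omega>\<bar> \<le> c / real (Suc m)}) \<longlonglongrightarrow> 0"
proof -
  interpret prob_space M
    using iid by (simp add: iid_copies_def)
  have [measurable]: "X i \<in> borel_measurable M" "X j \<in> borel_measurable M"
    using iid ij by (auto intro: iid_copies_measurable)
  \<comment> \<open>The absolute value makes the events decrease for either sign of \<open>c\<close>.\<close>
  define A where "A m = {\<omega>\<in>space M. \<bar>X i \<omega> - X j \<omega>\<bar> \<le> \<bar>c\<bar> / real (Suc m)}" for m
  have A[measurable]: "A m \<in> sets M" for m
    unfolding A_def by measurable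
  have "decseq A"
    unfolding decseq_def A_def by (auto elim!: order_trans intro!: divide_left_mono)
  then have "(\<lambda>m. measure M (A m)) \<longlonglongrightarrow> measure M (\<Inter>m. A m)"
    by (intro finite_Lim_measure_decseq) auto
  moreover have "measure M (\<Inter>m. A m) = 0"
  proof -
    have "X i \<omega> = X j \<omega>" if "\<omega> \<in> (\<Inter>m. A m)" for \<omega>
    proof -
      have "(\<lambda>m. \<bar>c\<bar> / real (Suc m)) \<longlonglongrightarrow> 0"
        by (rule LIMSEQ_Suc) (rule lim_const_over_n)
      then have "\<bar>X i \<omega> - X j \<omega>\<bar> \<le> 0"
        using that by (intro LIMSEQ_le_const) (auto simp: A_def)
      then show ?thesis by simp
    qed
    then have "AE \<omega> in M. \<omega> \<notin> (\<Inter>m. A m)"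
      by (intro eventually_mono[OF no_ties[OF assms]]) blast
    then show ?thesis
      by (subst prob_eq_0) auto
  qed
  ultimately have "(\<lambda>m. measure M (A m)) \<longlonglongrightarrow> 0"
    by simp
  then show ?thesis
  proof (rule tendsto_sandwich[OF _ _ tendsto_const, rotated 2])
    show "\<forall>\<^sub>F m in sequentially. measure M {\<omega>\<in>space M. \<bar>X i \<omega> - X j \<omega>\<bar> \<le> c / real (Suc m)} \<le> measure M (A m)"
      by (intro always_eventually allI finite_measure_mono A)
         (auto simp: A_def elim!: order_trans intro!: divide_right_mono)
  qed auto
qed

section \<open>Stopping rules as first entry times\<close>

text \<open>
  The time is forced to be at most \<open>n\<close>, and only the prefixes of \<open>x\<close> of length at most \<open>n\<close> are
  consulted. Since it is a function of the observed values, the same rule can be played on any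
  sample space.
\<close>
definition first_entry :: "(nat \<Rightarrow> (nat \<Rightarrow> real) set) \<Rightarrow> nat \<Rightarrow> (nat \<Rightarrow> real) \<Rightarrow> nat" where
  "first_entry B n x = (LEAST k. 1 \<le> k \<and> k \<le> n \<and> (k = n \<or> restrict x {1..k} \<in> B k))"

lemma first_entry_le_iff:
  assumes "n \<ge> 1"
  shows "first_entry B n x \<le> k \<longleftrightarrow>
    (\<exists>j\<in>{1..k}. j \<le> n \<and> (j = n \<or> restrict x {1..j} \<in> B j))"
proof
  let ?P = "\<lambda>k. 1 \<le> k \<and> k \<le> n \<and> (k = n \<or> restrict x {1..k} \<in> B k)"
  assume "first_entry B n x \<le> k"
  moreover have "?P (first_entry B n x)"
    unfolding first_entry_def by (rule LeastI[of ?P n]) (use assms in auto)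
  ultimately show "\<exists>j\<in>{1..k}. j \<le> n \<and> (j = n \<or> restrict x {1..j} \<in> B j)"
    by (intro bexI[of _ "first_entry B n x"]) auto
next
  assume "\<exists>j\<in>{1..k}. j \<le> n \<and> (j = n \<or> restrict x {1..j} \<in> B j)"
  then show "first_entry B n x \<le> k"
  proof (elim bexE)
    fix j assume j: "j \<in> {1..k}" "j \<le> n \<and> (j = n \<or> restrict x {1..j} \<in> B j)"
    then have "first_entry B n x \<le> j"
      unfolding first_entry_def by (intro Least_le) auto
    with j show "first_entry B n x \<le> k" by simp
  qed
qed

lemma first_entry_range:
  assumes "n \<ge> 1"
  shows "first_entry B n x \<in> {1..n}"
  using first_entry_le_iff[OF assms, of B x n] first_entry_le_iff[OF assms, of B x 0] assms
  by (auto simp: Suc_le_eq)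

lemma first_entry_restrict: "first_entry B n (restrict x {1..n}) = first_entry B n x"
proof -
  have "restrict (restrict x {1..n}) {1..k} = restrict x {1..k}" if "k \<le> n" for k
    using that by (auto simp: restrict_def fun_eq_iff)
  then show ?thesis
    unfolding first_entry_def by (intro arg_cong[where f=Least]) (auto simp: fun_eq_iff)
qed

text \<open>
  The decision to stop by time \<open>k\<close> uses only the first \<open>k\<close> variables. For this reason
  measurability of these alone suffices, and the lemma applies to the natural filtration at time
  \<open>k\<close> as well as to the full sigma-algebra.
\<close>
lemma measurable_first_entry_le:
  assumes "n \<ge> 1" and B: "\<And>k. B k \<in> sets (\<Pi>\<^sub>M i\<in>{1..k}. borel)"
    and Z: "\<And>i. i \<in> {1..k} \<Longrightarrow> i \<le> n \<Longrightarrow> Z i \<in> borel_measurable N"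
  shows "Measurable.pred N (\<lambda>\<omega>. first_entry B n (\<lambda>i. Z i \<omega>) \<le> k)"
proof -
  have entry: "Measurable.pred N (\<lambda>\<omega>. j \<le> n \<and> (j = n \<or> (\<lambda>i\<in>{1..j}. Z i \<omega>) \<in> B j))"
    if "j \<in> {1..k}" for j
  proof (cases "j \<le> n")
    case True
    then have "(\<lambda>\<omega>. \<lambda>i\<in>{1..j}. Z i \<omega>) \<in> measurable N (\<Pi>\<^sub>M i\<in>{1..j}. borel)"
      using that by (intro measurable_restrict Z) auto
    from pred_sets2[OF B this] show ?thesis
      by (intro pred_intros_logic) auto
  qed simp
  show ?thesis
    unfolding first_entry_le_iff[OF assms(1)]
    by (intro pred_intros_finite entry finite_atLeastAtMost)
qed

lemma measurable_first_entry_wins: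
  assumes n: "n \<ge> 1" and B: "\<And>k. B k \<in> sets (\<Pi>\<^sub>M i\<in>{1..k}. borel)"
    and Z: "\<And>i. i \<in> {1..n} \<Longrightarrow> Z i \<in> borel_measurable N"
  shows "Measurable.pred N
    (\<lambda>\<omega>. \<forall>j\<in>{1..n}. c * Z j \<omega> \<le> Z (first_entry B n (\<lambda>i. Z i \<omega>)) \<omega>)"
proof -
  have [measurable]: "Measurable.pred N (\<lambda>\<omega>. first_entry B n (\<lambda>i. Z i \<omega>) \<le> k)" for k
    using assms by (intro measurable_first_entry_le) auto
  have "Measurable.pred N (\<lambda>\<omega>. \<exists>k\<in>{1..n}. (first_entry B n (\<lambda>i. Z i \<omega>) \<le> k \<and>
      \<not> first_entry B n (\<lambda>i. Z i \<omega>) \<le> k - 1) \<and> (\<forall>j\<in>{1..n}. c * Z j \<omega> \<le> Z k \<omega>))"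
  proof (intro pred_intros_finite pred_intros_logic)
    fix k j assume "k \<in> {1..n}" "j \<in> {1..n}"
    then have [measurable]: "Z k \<in> borel_measurable N" "Z j \<in> borel_measurable N"
      using Z by auto
    show "Measurable.pred N (\<lambda>\<omega>. c * Z j \<omega> \<le> Z k \<omega>)"
      by measurable
  qed auto
  moreover have "(\<exists>k\<in>{1..n}. (first_entry B n x \<le> k \<and> \<not> first_entry B n x \<le> k - 1) \<and> Q k)
      \<longleftrightarrow> Q (first_entry B n x)" for x Q
  proof -
    have "(first_entry B n x \<le> k \<and> \<not> first_entry B n x \<le> k - 1) \<longleftrightarrow> k = first_entry B n x"
      if "k \<in> {1..n}" for k
      using that by auto
    then show ?thesis
      using first_entry_range[OF n, of B x] by blast
  qed
  ultimately show ?thesis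
    by simp
qed

text \<open>
  A player may first transform each observation by \<open>h\<close>: the transformed prefix is still a
  measurable function of the observed one.
\<close>
lemma first_entry_stopping_rule:
  assumes n: "n \<ge> 1" and B: "\<And>k. B k \<in> sets (\<Pi>\<^sub>M i\<in>{1..k}. borel)"
    and h: "h \<in> borel_measurable borel"
  shows "(\<lambda>\<omega>. first_entry B n (\<lambda>i. h (X i \<omega>))) \<in> stopping_rules M X n"
proof -
  have "(\<lambda>\<omega>. h (X i \<omega>)) \<in> borel_measurable (nat_filtration M X k)" if "i \<in> {1..k}" for i k
  proof -
    have "(\<lambda>\<omega>. \<lambda>i\<in>{1..k}. X i \<omega>) \<in> measurable (nat_filtration M X k) (\<Pi>\<^sub>M i\<in>{1..k}. borel)"
      unfolding nat_filtration_def by (rule measurable_vimage_algebra1) (auto simp: space_PiM)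
    from measurable_compose[OF this measurable_component_singleton[OF that]]
    have "X i \<in> borel_measurable (nat_filtration M X k)"
      using that by (simp add: restrict_def)
    then show ?thesis
      using h by (rule measurable_compose)
  qed
  then show ?thesis
    unfolding stopping_rules_def stopping_time_def
    using first_entry_range[OF n] by (auto intro!: measurable_first_entry_le n B)
qed

text \<open>
  Every event in the sigma-algebra generated by \<open>X 1, \<dots>, X k\<close> is the preimage of a measurable set
  of vectors. Taking such a set \<open>B k\<close> for the event \<open>\<tau> \<le> k\<close> for each \<open>k\<close>, the rule stops at the
  first \<open>k\<close> for which the prefix lies in \<open>B k\<close>.
\<close>
lemma stopping_rule_is_first_entry:
  assumes n: "n \<ge> 1" and \<tau>: "\<tau> \<in> stopping_rules M X n"
  obtains B where "\<And>k. B k \<in> sets (\<Pi>\<^sub>M i\<in>{1..k}. borel)"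
    "\<And>\<omega>. \<omega> \<in> space M \<Longrightarrow> \<tau> \<omega> = first_entry B n (\<lambda>i. X i \<omega>)"
proof -
  have "\<exists>B. B \<in> sets (\<Pi>\<^sub>M i\<in>{1..k}. borel) \<and>
      (\<forall>\<omega>\<in>space M. \<tau> \<omega> \<le> k \<longleftrightarrow> (\<lambda>i\<in>{1..k}. X i \<omega>) \<in> B)" for k
  proof -
    have "{\<omega>\<in>space M. \<tau> \<omega> \<le> k} \<in> sets (nat_filtration M X k)"
      using \<tau> unfolding stopping_rules_def stopping_time_def
      by (auto simp: pred_def nat_filtration_def)
    also have "sets (nat_filtration M X k) =
        {(\<lambda>\<omega>. \<lambda>i\<in>{1..k}. X i \<omega>) -` A \<inter> space M | A. A \<in> sets (\<Pi>\<^sub>M i\<in>{1..k}. borel)}"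
      unfolding nat_filtration_def by (rule sets_vimage_algebra2) (auto simp: space_PiM)
    finally obtain A where "A \<in> sets (\<Pi>\<^sub>M i\<in>{1..k}. borel)"
      "{\<omega>\<in>space M. \<tau> \<omega> \<le> k} = (\<lambda>\<omega>. \<lambda>i\<in>{1..k}. X i \<omega>) -` A \<inter> space M"
      by blast
    then show ?thesis
      by (intro exI[of _ A]) blast
  qed
  then obtain B where B: "\<And>k. B k \<in> sets (\<Pi>\<^sub>M i\<in>{1..k}. borel)"
    and \<tau>_B: "\<And>k \<omega>. \<omega> \<in> space M \<Longrightarrow> \<tau> \<omega> \<le> k \<longleftrightarrow> (\<lambda>i\<in>{1..k}. X i \<omega>) \<in> B k"
    by metis
  have "\<tau> \<omega> = first_entry B n (\<lambda>i. X i \<omega>)" if \<omega>: "\<omega> \<in> space M" for \<omega>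
  proof -
    have rng: "\<tau> \<omega> \<in> {1..n}"
      using \<tau> \<omega> by (auto simp: stopping_rules_def)
    have "first_entry B n (\<lambda>i. X i \<omega>) \<le> k \<longleftrightarrow> \<tau> \<omega> \<le> k" for k
    proof -
      have "first_entry B n (\<lambda>i. X i \<omega>) \<le> k \<longleftrightarrow> (\<exists>j\<in>{1..k}. j \<le> n \<and> (j = n \<or> \<tau> \<omega> \<le> j))"
        using first_entry_le_iff[OF n] \<tau>_B[OF \<omega>] by simp
      also have "\<dots> \<longleftrightarrow> \<tau> \<omega> \<le> k"
        using rng by (auto intro!: bexI[of _ "\<tau> \<omega>"])
      finally show ?thesis .
    qed
    from this[of "\<tau> \<omega>"] this[of "first_entry B n (\<lambda>i. X i \<omega>)"] show ?thesis
      by auto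
  qed
  with B show ?thesis
    using that by blast
qed

section \<open>Win probabilities\<close>

lemma mult_sample_max_le_iff:
  assumes "n \<ge> 1" "0 \<le> c"
  shows "c * sample_max X n \<omega> \<le> y \<longleftrightarrow> (\<forall>j\<in>{1..n}. c * X j \<omega> \<le> y)"
proof -
  have ne: "finite ((\<lambda>i. X i \<omega>) ` {1..n})" "(\<lambda>i. X i \<omega>) ` {1..n} \<noteq> {}"
    using assms by auto
  obtain i where "i \<in> {1..n}" "sample_max X n \<omega> = X i \<omega>"
    using Max_in[OF ne] unfolding sample_max_def by auto
  moreover have "c * X j \<omega> \<le> c * sample_max X n \<omega>" if "j \<in> {1..n}" for j
    unfolding sample_max_def using that assms ne by (intro mult_left_mono Max_ge) auto
  ultimately show ?thesis
    by (metis order_trans)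
qed

text \<open>
  The event that \<open>\<tau>\<close> wins the game with proportion \<open>c\<close>, with the comparison against the maximum
  written out coordinatewise; \<open>c = 1\<close> is Game Max.
\<close>
definition win :: "real \<Rightarrow> 'a measure \<Rightarrow> (nat \<Rightarrow> 'a \<Rightarrow> real) \<Rightarrow> nat \<Rightarrow> ('a \<Rightarrow> nat) \<Rightarrow> 'a set" where
  "win c M X n \<tau> = {\<omega>\<in>space M. \<forall>j\<in>{1..n}. c * X j \<omega> \<le> X (\<tau> \<omega>) \<omega>}"

lemma V_prop_max_eq:
  assumes "n \<ge> 1" "0 \<le> c"
  shows "V_prop_max c M X n = (SUP \<tau>\<in>stopping_rules M X n. measure M (win c M X n \<tau>))"
  using assms by (simp add: V_prop_max_def win_def mult_sample_max_le_iff)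

lemma V_max_eq: "V_max M X n = V_prop_max 1 M X n"
  by (simp add: V_max_def V_prop_max_def)

lemma win_measurable:
  assumes iid: "iid_copies M X n D" and n: "n \<ge> 1" and \<tau>: "\<tau> \<in> stopping_rules M X n"
  shows "win c M X n \<tau> \<in> sets M"
proof -
  obtain B where B: "\<And>k. B k \<in> sets (\<Pi>\<^sub>M i\<in>{1..k}. borel)"
    "\<And>\<omega>. \<omega> \<in> space M \<Longrightarrow> \<tau> \<omega> = first_entry B n (\<lambda>i. X i \<omega>)"
    using stopping_rule_is_first_entry[OF n \<tau>] by metis
  have "Measurable.pred M (\<lambda>\<omega>. \<forall>j\<in>{1..n}. c * X j \<omega> \<le> X (first_entry B n (\<lambda>i. X i \<omega>)) \<omega>)"
    by (rule measurable_first_entry_wins[OF n B(1) iid_copies_measurable[OF iid]])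
  then show ?thesis
    by (simp add: pred_def win_def B(2) cong: conj_cong)
qed

lemma stopping_rules_nonempty:
  assumes "n \<ge> 1"
  shows "stopping_rules M X n \<noteq> {}"
proof -
  have "(\<lambda>\<omega>. first_entry (\<lambda>_. {}) n (\<lambda>i. X i \<omega>)) \<in> stopping_rules M X n"
    by (rule first_entry_stopping_rule[OF assms, where h = "\<lambda>x. x"]) simp_all
  then show ?thesis by blast
qed

lemma win_le_V_prop_max:
  assumes "prob_space M" "n \<ge> 1" "0 \<le> c" "\<tau> \<in> stopping_rules M X n"
  shows "measure M (win c M X n \<tau>) \<le> V_prop_max c M X n"
  unfolding V_prop_max_eq[OF assms(2,3)]
  using assms(4) by (intro cSUP_upper bdd_aboveI[of _ 1]) (auto simp: prob_space.prob_le_1[OF assms(1)])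

text \<open>
  Both the stopping time and the win are functions of the sample vector, so the win probability
  is determined by the joint law, which is the product of the copies of \<open>D\<close>.
\<close>
lemma win_probability_by_law:
  assumes iid: "iid_copies M X n D" and n: "n \<ge> 1"
    and B: "\<And>k. B k \<in> sets (\<Pi>\<^sub>M i\<in>{1..k}. borel)"
  shows "measure M (win c M X n (\<lambda>\<omega>. first_entry B n (\<lambda>i. X i \<omega>))) =
    measure (\<Pi>\<^sub>M i\<in>{1..n}. D) (win c (\<Pi>\<^sub>M i\<in>{1..n}. D) (\<lambda>i x. x i) n (first_entry B n))"
proof -
  let ?P = "\<Pi>\<^sub>M i\<in>{1..n}. (borel :: real measure)"
  let ?X = "\<lambda>\<omega>. \<lambda>i\<in>{1..n}. X i \<omega>"
  let ?W = "{x\<in>space ?P. \<forall>j\<in>{1..n}. c * x j \<le> x (first_entry B n x)}"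
  have X: "?X \<in> measurable M ?P"
    using iid_copies_measurable[OF iid] by (intro measurable_restrict) auto
  have W: "?W \<in> sets ?P"
    using measurable_first_entry_wins[OF n B, of "\<lambda>i x. x i" ?P c]
      measurable_component_singleton[of _ "{1..n}" "\<lambda>_. borel :: real measure"]
    by (simp add: pred_def)
  have law: "distr M ?P ?X = (\<Pi>\<^sub>M i\<in>{1..n}. D)"
    by (rule iid_copies_joint_law[OF iid n])
  have "measure (\<Pi>\<^sub>M i\<in>{1..n}. D) (win c (\<Pi>\<^sub>M i\<in>{1..n}. D) (\<lambda>i x. x i) n (first_entry B n))
      = measure (distr M ?P ?X) ?W"
    unfolding law[symmetric] by (simp add: win_def)
  also have "\<dots> = measure M (?X -` ?W \<inter> space M)"
    by (rule measure_distr[OF X W])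
  also have "?X -` ?W \<inter> space M = win c M X n (\<lambda>\<omega>. first_entry B n (\<lambda>i. X i \<omega>))"
  proof (intro set_eqI)
    fix \<omega>
    have "?X \<omega> (first_entry B n (?X \<omega>)) = X (first_entry B n (\<lambda>i. X i \<omega>)) \<omega>"
      using first_entry_range[OF n, of B "\<lambda>i. X i \<omega>"] by (simp only: first_entry_restrict restrict_apply')
    then show "\<omega> \<in> ?X -` ?W \<inter> space M \<longleftrightarrow>
        \<omega> \<in> win c M X n (\<lambda>\<omega>. first_entry B n (\<lambda>i. X i \<omega>))"
      using measurable_space[OF X, of \<omega>] by (auto simp: win_def)
  qed
  finally show ?thesis ..
qed

section \<open>The optimal win probability does not depend on the continuous law\<close>

text \<open>
  A rule for \<open>X\<close> is imitated on \<open>X'\<close> by applying it to the transported observations \<open>g (X' i)\<close>,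
  which have the joint law of \<open>X\<close>. The two sample spaces may have different types.
\<close>
lemma V_max_le:
  assumes iid: "iid_copies M X n D" and D: "continuous_law D"
    and iid': "iid_copies M' X' n D'" and D': "continuous_law D'" and n: "n \<ge> 1"
  shows "V_max M X n \<le> V_max M' X' n"
proof -
  interpret M': prob_space M'
    using iid' by (simp add: iid_copies_def)
  obtain g S where g: "g \<in> borel_measurable borel" "mono_on S g"
    and S: "AE x in D'. x \<in> S" and law: "distr D' borel g = D"
    using monotone_transport_exists[of D D'] D D' by (auto simp: continuous_law_def)
  let ?Y = "\<lambda>i \<omega>. g (X' i \<omega>)"
  have iid_Y: "iid_copies M' ?Y n D"
    using iid_copies_compose[OF iid' g(1)] by (simp add: law)
  have AE_S: "AE \<omega> in M'. X' i \<omega> \<in> S" if "i \<in> {1..n}" for i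
    using iid_copies_AE[OF iid' that S] .
  have "measure M (win 1 M X n \<tau>) \<le> V_prop_max 1 M' X' n" if \<tau>: "\<tau> \<in> stopping_rules M X n" for \<tau>
  proof -
    obtain B where B: "\<And>k. B k \<in> sets (\<Pi>\<^sub>M i\<in>{1..k}. borel)"
      and \<tau>_B: "\<And>\<omega>. \<omega> \<in> space M \<Longrightarrow> \<tau> \<omega> = first_entry B n (\<lambda>i. X i \<omega>)"
      using stopping_rule_is_first_entry[OF n \<tau>] by metis
    define \<sigma> where "\<sigma> \<omega> = first_entry B n (\<lambda>i. ?Y i \<omega>)" for \<omega>
    have \<sigma>: "\<sigma> \<in> stopping_rules M' X' n"
      unfolding \<sigma>_def by (rule first_entry_stopping_rule[OF n B g(1)])
    have rng: "\<sigma> \<omega> \<in> {1..n}" for \<omega>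
      unfolding \<sigma>_def by (rule first_entry_range[OF n])
    have "measure M (win 1 M X n \<tau>) = measure M (win 1 M X n (\<lambda>\<omega>. first_entry B n (\<lambda>i. X i \<omega>)))"
      by (intro arg_cong[where f="measure M"]) (auto simp: win_def \<tau>_B)
    also have "\<dots> = measure M' (win 1 M' ?Y n \<sigma>)"
      unfolding \<sigma>_def using win_probability_by_law[OF iid n B] win_probability_by_law[OF iid_Y n B]
      by simp
    also have "\<dots> \<le> measure M' (win 1 M' X' n \<sigma>)"
    proof (rule M'.finite_measure_mono_AE)
      have "AE \<omega> in M'. \<forall>i\<in>{1..n}. \<forall>j\<in>{1..n}. i \<noteq> j \<longrightarrow> ?Y i \<omega> \<noteq> ?Y j \<omega>"
        using no_ties[OF iid_Y D] by (intro AE_finite_allI AE_impI) auto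
      moreover have "AE \<omega> in M'. \<forall>i\<in>{1..n}. X' i \<omega> \<in> S"
        using AE_S by (intro AE_finite_allI) auto
      ultimately show "AE \<omega> in M'. \<omega> \<in> win 1 M' ?Y n \<sigma> \<longrightarrow> \<omega> \<in> win 1 M' X' n \<sigma>"
      proof eventually_elim
        case (elim \<omega>)
        have "X' j \<omega> \<le> X' (\<sigma> \<omega>) \<omega>" if win: "?Y j \<omega> \<le> ?Y (\<sigma> \<omega>) \<omega>" and j: "j \<in> {1..n}" for j
        proof (rule ccontr)
          \<comment> \<open>By monotonicity, \<open>g\<close> can reverse no strict inequality; it could only create a tie.\<close>
          assume "\<not> X' j \<omega> \<le> X' (\<sigma> \<omega>) \<omega>"
          moreover from this have "?Y (\<sigma> \<omega>) \<omega> \<le> ?Y j \<omega>"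
            using elim(2) j rng by (intro mono_onD[OF g(2)]) auto
          ultimately show False
            using elim(1) j rng[of \<omega>] win by (metis antisym order_refl)
        qed
        then show ?case
          by (auto simp: win_def)
      qed
    qed (rule win_measurable[OF iid' n \<sigma>])
    also have "\<dots> \<le> V_prop_max 1 M' X' n"
      by (rule win_le_V_prop_max[OF M'.prob_space_axioms n _ \<sigma>]) simp
    finally show ?thesis .
  qed
  then show ?thesis
    unfolding V_max_eq V_prop_max_eq[of n 1 M X, OF n zero_le_one]
    by (intro cSUP_least stopping_rules_nonempty n) auto
qed

lemma V_max_unique:
  assumes "iid_copies M X n D" "continuous_law D"
    "iid_copies M' X' n D'" "continuous_law D'" "n \<ge> 1"
  shows "V_max M X n = V_max M' X' n"
  using V_max_le[of M X n D M' X' D'] V_max_le[of M' X' n D' M X D] assms by auto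

lemma V_max_eq_v_max:
  assumes iid: "iid_copies M X n D" and D: "continuous_law D" and n: "n \<ge> 1"
  shows "V_max M X n = v_max n"
proof -
  let ?P = "\<lambda>v. \<forall>D (M :: (nat \<Rightarrow> real) measure) X.
     continuous_law D \<longrightarrow> iid_copies M X n D \<longrightarrow> V_max M X n = v"
  have "?P (V_max M X n)"
    using V_max_unique iid D n by blast
  moreover have "v = V_max M X n" if "?P v" for v
  proof -
    have coords: "iid_copies (\<Pi>\<^sub>M i\<in>{1..n}. D) (\<lambda>i \<omega>. \<omega> i) n D"
      using D n by (intro iid_copies_coordinates) (auto simp: continuous_law_def)
    then have "V_max (\<Pi>\<^sub>M i\<in>{1..n}. D) (\<lambda>i \<omega>. \<omega> i) n = v"
      using that D by blast
    then show ?thesis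
      using V_max_unique[OF iid D coords D n] by simp
  qed
  ultimately show ?thesis
    unfolding v_max_def by (intro the_equality[symmetric]) auto
qed

lemma V_prop_max_ge_V_max:
  assumes iid: "iid_copies M X n D" and nonneg: "AE x in D. 0 \<le> x" and n: "n \<ge> 1"
    and c: "0 \<le> c" "c \<le> 1"
  shows "V_max M X n \<le> V_prop_max c M X n"
proof -
  interpret prob_space M
    using iid by (simp add: iid_copies_def)
  have "AE \<omega> in M. 0 \<le> X i \<omega>" if "i \<in> {1..n}" for i
    using iid_copies_AE[OF iid that nonneg] .
  then have pos: "AE \<omega> in M. \<forall>i\<in>{1..n}. 0 \<le> X i \<omega>"
    by (intro AE_finite_allI) auto
  have "measure M (win 1 M X n \<tau>) \<le> V_prop_max c M X n" if \<tau>: "\<tau> \<in> stopping_rules M X n" for \<tau>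
  proof -
    have "measure M (win 1 M X n \<tau>) \<le> measure M (win c M X n \<tau>)"
    proof (rule finite_measure_mono_AE)
      show "AE \<omega> in M. \<omega> \<in> win 1 M X n \<tau> \<longrightarrow> \<omega> \<in> win c M X n \<tau>"
        using pos
      proof eventually_elim
        case (elim \<omega>)
        then have "c * X j \<omega> \<le> X j \<omega>" if "j \<in> {1..n}" for j
          using c that by (simp add: mult_left_le_one_le)
        then show ?case
          by (force simp: win_def)
      qed
    qed (rule win_measurable[OF iid n \<tau>])
    also have "\<dots> \<le> V_prop_max c M X n"
      by (rule win_le_V_prop_max[OF prob_space_axioms n c(1) \<tau>])
    finally show ?thesis .
  qed
  then show ?thesis
    unfolding V_max_eq V_prop_max_eq[of n 1 M X, OF n zero_le_one]
    by (intro cSUP_least stopping_rules_nonempty n) auto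
qed

section \<open>Sharpness for widely spread laws\<close>

lemma continuous_law_distr_inj:
  assumes "continuous_law D" "inj h" and h: "h \<in> borel_measurable borel"
  shows "continuous_law (distr D borel h)"
proof -
  interpret D: real_distribution D
    using assms(1) by (simp add: continuous_law_def)
  have h': "h \<in> borel_measurable D"
    using h by (simp cong: measurable_cong_sets)
  have "measure (distr D borel h) {y} = 0" for y
  proof -
    have "h -` {y} = {} \<or> (\<exists>x. h -` {y} = {x})"
      using inj_vimage_singleton[OF assms(2), of y] subset_singletonD by metis
    then show ?thesis
      using assms(1) by (auto simp: measure_distr[OF h'] D.borel_UNIV continuous_law_iff_no_atoms)
  qed
  then show ?thesis
    using D.real_distribution_distr[OF h'] by (simp add: continuous_law_iff_no_atoms)
qed

lemma continuous_law_uniform: "continuous_law (uniform_measure lborel {0..1::real})"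
proof -
  interpret prob_space "uniform_measure lborel {0..1::real}"
    by (rule prob_space_uniform_measure) auto
  have "measure (uniform_measure lborel {0..1::real}) {x} = 0" for x
    using emeasure_mono[of "{0..1} \<inter> {x}" "{x}" lborel]
    by (simp add: measure_def emeasure_uniform_measure)
  then show ?thesis
    unfolding continuous_law_iff_no_atoms real_distribution_def real_distribution_axioms_def
    by (simp add: prob_space_axioms)
qed

text \<open>
  After taking logarithms, the proportion \<open>c\<close> becomes the additive tolerance \<open>- ln c / K\<close> on the
  scale of \<open>Y\<close>. A stop that wins with proportion \<open>c\<close> but loses Game Max therefore needs two of
  the \<open>Y\<close>'s within that tolerance, and a union bound over the pairs estimates this.
\<close>
lemma V_prop_max_exp_le:
  assumes iid: "iid_copies M Y n D" and n: "n \<ge> 1" and K: "0 < K" and c: "0 < c"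
  shows "V_prop_max c M (\<lambda>i \<omega>. exp (K * Y i \<omega>)) n \<le> V_max M (\<lambda>i \<omega>. exp (K * Y i \<omega>)) n +
    (\<Sum>(i, j)\<in>{(i, j)\<in>{1..n} \<times> {1..n}. i \<noteq> j}. measure M {\<omega>\<in>space M. \<bar>Y i \<omega> - Y j \<omega>\<bar> \<le> - ln c / K})"
    (is "?V \<le> ?W + (\<Sum>(i, j)\<in>?I. measure M (?N i j))")
proof -
  interpret prob_space M
    using iid by (simp add: iid_copies_def)
  let ?X = "\<lambda>i \<omega>. exp (K * Y i \<omega>)"
  have iid_X: "iid_copies M ?X n (distr D borel (\<lambda>y. exp (K * y)))"
    by (rule iid_copies_compose[OF iid]) measurable
  have fin: "finite ?I"
    by (rule finite_subset[of _ "{1..n} \<times> {1..n}"]) auto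
  have N: "?N i j \<in> sets M" if "(i, j) \<in> ?I" for i j
  proof -
    have [measurable]: "Y i \<in> borel_measurable M" "Y j \<in> borel_measurable M"
      using that iid_copies_measurable[OF iid] by auto
    show ?thesis by measurable
  qed
  have "measure M (win c M ?X n \<tau>) \<le> ?W + (\<Sum>(i, j)\<in>?I. measure M (?N i j))"
    if \<tau>: "\<tau> \<in> stopping_rules M ?X n" for \<tau>
  proof -
    have "win c M ?X n \<tau> \<subseteq> win 1 M ?X n \<tau> \<union> (\<Union>(i, j)\<in>?I. ?N i j)"
    proof
      fix \<omega> assume \<omega>: "\<omega> \<in> win c M ?X n \<tau>"
      show "\<omega> \<in> win 1 M ?X n \<tau> \<union> (\<Union>(i, j)\<in>?I. ?N i j)"
      proof (cases "\<omega> \<in> win 1 M ?X n \<tau>")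
        case False
        then obtain j where j: "j \<in> {1..n}" "K * Y (\<tau> \<omega>) \<omega> < K * Y j \<omega>"
          using \<omega> by (auto simp: win_def not_le)
        have "exp (ln c + K * Y j \<omega>) \<le> exp (K * Y (\<tau> \<omega>) \<omega>)"
          using \<omega> j c by (auto simp: win_def exp_add)
        then have "ln c + K * Y j \<omega> \<le> K * Y (\<tau> \<omega>) \<omega>"
          by simp
        then have "\<bar>Y (\<tau> \<omega>) \<omega> - Y j \<omega>\<bar> \<le> - ln c / K"
          using j K by (simp add: field_simps abs_if)
        moreover have "(\<tau> \<omega>, j) \<in> ?I"
          using \<tau> \<omega> j by (auto simp: stopping_rules_def win_def)
        ultimately show ?thesis
          using \<omega> by (auto simp: win_def)
      qed simp
    qed
    then have "measure M (win c M ?X n \<tau>) \<le> measure M (win 1 M ?X n \<tau> \<union> (\<Union>(i, j)\<in>?I. ?N i j))"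
      using N fin by (intro finite_measure_mono sets.Un sets.finite_UN win_measurable[OF iid_X n \<tau>]) auto
    also have "\<dots> \<le> measure M (win 1 M ?X n \<tau>) + measure M (\<Union>(i, j)\<in>?I. ?N i j)"
      using N fin by (intro measure_Un_le sets.finite_UN win_measurable[OF iid_X n \<tau>]) auto
    also have "measure M (\<Union>(i, j)\<in>?I. ?N i j) \<le> (\<Sum>p\<in>?I. measure M (case p of (i, j) \<Rightarrow> ?N i j))"
      using N fin by (intro finite_measure_subadditive_finite) auto
    also have "measure M (win 1 M ?X n \<tau>) \<le> ?W"
      unfolding V_max_eq by (rule win_le_V_prop_max[OF prob_space_axioms n _ \<tau>]) simp
    finally show ?thesis
      by (simp add: case_prod_unfold)
  qed
  then show ?thesis
    using c unfolding V_prop_max_eq[OF n less_imp_le[OF c]]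
    by (intro cSUP_least stopping_rules_nonempty n) auto
qed

theorem theorem1p1:
  fixes \<alpha> :: real and n :: nat
  assumes "0 < \<alpha>" and "\<alpha> < 1" and "n \<ge> 1"
  shows "(\<forall>D (M :: 'a measure) X.
            continuous_law D \<longrightarrow> (AE x in D. 0 \<le> x) \<longrightarrow> iid_copies M X n D \<longrightarrow>
              V_prop_max \<alpha> M X n \<ge> v_max n) \<and>
         (\<forall>\<delta>>0. \<exists>D (M :: (nat \<Rightarrow> real) measure) X.
            continuous_law D \<and> (AE x in D. 0 \<le> x) \<and> iid_copies M X n D \<and>
              V_prop_max \<alpha> M X n \<le> v_max n + \<delta>)"
proof (intro conjI allI impI)
  fix D :: "real measure" and M :: "'a measure" and X
  assume D: "continuous_law D" and nonneg: "AE x in D. 0 \<le> x" and iid: "iid_copies M X n D"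
  show "v_max n \<le> V_prop_max \<alpha> M X n"
    using V_prop_max_ge_V_max[OF iid nonneg \<open>n \<ge> 1\<close>, of \<alpha>] V_max_eq_v_max[OF iid D \<open>n \<ge> 1\<close>] assms
    by simp
next
  fix \<delta> :: real assume "0 < \<delta>"
  define U where "U = uniform_measure lborel {0..1::real}"
  define M where "M = (\<Pi>\<^sub>M i\<in>{1..n}. U)"
  let ?Y = "\<lambda>i (\<omega> :: nat \<Rightarrow> real). \<omega> i"
  let ?I = "{(i, j)\<in>{1..n} \<times> {1..n}. i \<noteq> j}"
  have U: "continuous_law U"
    unfolding U_def by (rule continuous_law_uniform)
  have Y: "iid_copies M ?Y n U"
    unfolding M_def using U assms by (intro iid_copies_coordinates) (auto simp: continuous_law_def)
  define r where "r m = (\<Sum>(i, j)\<in>?I.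
    measure M {\<omega>\<in>space M. \<bar>?Y i \<omega> - ?Y j \<omega>\<bar> \<le> - ln \<alpha> / real (Suc m)})" for m
  have "r \<longlonglongrightarrow> (\<Sum>(i, j)\<in>?I. 0)"
    unfolding r_def case_prod_unfold
    by (intro tendsto_sum near_ties_vanish[OF Y U]) auto
  then have "r \<longlonglongrightarrow> 0"
    by (simp add: case_prod_unfold)
  then obtain m where m: "r m < \<delta>"
    using order_tendstoD(2)[OF _ \<open>0 < \<delta>\<close>] by (fastforce simp: eventually_sequentially)
  define h where "h y = exp (real (Suc m) * y)" for y
  have h: "h \<in> borel_measurable borel"
    unfolding h_def by measurable
  have "inj h"
    by (auto simp: inj_def h_def)
  define D where "D = distr U borel h"
  have D: "continuous_law D"
    unfolding D_def by (rule continuous_law_distr_inj[OF U \<open>inj h\<close> h])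
  have X: "iid_copies M (\<lambda>i \<omega>. h (\<omega> i)) n D"
    unfolding D_def by (rule iid_copies_compose[OF Y h])
  have "h \<in> borel_measurable U"
    using h by (simp add: U_def cong: measurable_cong_sets)
  then have "AE x in D. 0 \<le> x"
    unfolding D_def by (subst AE_distr_iff) (auto simp: h_def)
  moreover have "V_prop_max \<alpha> M (\<lambda>i \<omega>. h (\<omega> i)) n \<le> v_max n + \<delta>"
    using V_prop_max_exp_le[OF Y \<open>n \<ge> 1\<close> _ \<open>0 < \<alpha>\<close>, of "real (Suc m)"] m
      V_max_eq_v_max[OF X D \<open>n \<ge> 1\<close>]
    by (simp add: h_def r_def)
  ultimately show "\<exists>D (M :: (nat \<Rightarrow> real) measure) X.
      continuous_law D \<and> (AE x in D. 0 \<le> x) \<and> iid_copies M X n D \<and>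
        V_prop_max \<alpha> M X n \<le> v_max n + \<delta>"
    using D X by blast
qed

end
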